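(* Let $a_1,b_1,a_2,b_2,a_3,b_3$ be real numbers satisfying condition $(\Omega)$ (defined in the context). For $i\in\{1,2,3\}$ and $c_i\in[a_i,b_i]$ let $T_i(c_i)$ be the total volume of the convex-hull relaxations of the two children after branching on $x_i$ at $c_i$ (defined in the context). Then, with optimal branching-point selection, branching on $x_1$ obtains the least total volume and branching on $x_3$ obtains the greatest total volume: $$\min_{c_1\in[a_1,b_1]}T_1(c_1)\ \le\ \min_{c_2\in[a_2,b_2]}T_2(c_2)\ \le\ \min_{c_3\in[a_3,b_3]}T_3(c_3).$$ Additionally, branching on $x_1$ at the midpoint is at least as good as optimal branching on $x_2$ or on $x_3$: $$T_1\Big(\frac{a_1+b_1}{2}\Big)\le\min_{c_2\in[a_2,b_2]}T_2(c_2)\quad\text{and}\quad T_1\Big(\frac{a_1+b_1}{2}\Big)\le\min_{c_3\in[a_3,b_3]}T_3(c_3).$$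
   Context: Condition $(\Omega)$ on real numbers $a_1,b_1,a_2,b_2,a_3,b_3$: $0\le a_i<b_i$ for $i=1,2,3$, and $a_1b_2b_3+b_1a_2a_3\le b_1a_2b_3+a_1b_2a_3\le b_1b_2a_3+a_1a_2b_3$ (equivalently, $\frac{a_1}{b_1}\le\frac{a_2}{b_2}\le\frac{a_3}{b_3}$). For a box $B=[l_1,u_1]\times[l_2,u_2]\times[l_3,u_3]\subset\mathbb{R}^3$ with $0\le l_i\le u_i$, let $\mathcal{P}_h(B)=\operatorname{conv}\{(f,x_1,x_2,x_3)\in\mathbb{R}^4: f=x_1x_2x_3,\ (x_1,x_2,x_3)\in B\}$ (the convex-hull relaxation of the trilinear monomial $x_1x_2x_3$ on $B$), and let $\operatorname{vol}$ denote $4$-dimensional Lebesgue measure. Let $B_0=[a_1,b_1]\times[a_2,b_2]\times[a_3,b_3]$. For $c_i\in[a_i,b_i]$, the total volume after branching on $x_i$ at $c_i$ is $$T_i(c_i)=\operatorname{vol}\big(\mathcal{P}_h(B_0\cap\{x_i\le c_i\})\big)+\operatorname{vol}\big(\mathcal{P}_h(B_0\cap\{x_i\ge c_i\})\big).$$ *)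

theory Defs
  imports "HOL-Analysis.Analysis"
begin

definition Omega :: "real \<Rightarrow> real \<Rightarrow> real \<Rightarrow> real \<Rightarrow> real \<Rightarrow> real \<Rightarrow> bool" where
  "Omega a1 b1 a2 b2 a3 b3 \<longleftrightarrow>
     (0 \<le> a1 \<and> a1 < b1) \<and> (0 \<le> a2 \<and> a2 < b2) \<and> (0 \<le> a3 \<and> a3 < b3) \<and>
     a1 * b2 * b3 + b1 * a2 * a3 \<le> b1 * a2 * b3 + a1 * b2 * a3 \<and>
     b1 * a2 * b3 + a1 * b2 * a3 \<le> b1 * b2 * a3 + a1 * a2 * b3"

definition hull_relaxation :: "(real \<times> real \<times> real) set \<Rightarrow> (real \<times> real \<times> real \<times> real) set" where
  "hull_relaxation B = convex hull {(f, x1, x2, x3). f = x1 * x2 * x3 \<and> (x1, x2, x3) \<in> B}"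

definition vol :: "(real \<times> real \<times> real \<times> real) set \<Rightarrow> real" where
  "vol S = measure lebesgue S"

text \<open>The argument \<open>p\<close> is the coordinate projection of the branching variable.\<close>

definition branching_volume ::
  "(real \<times> real \<times> real \<Rightarrow> real) \<Rightarrow> (real \<times> real \<times> real) set \<Rightarrow> real \<Rightarrow> real" where
  "branching_volume p B c =
     vol (hull_relaxation (B \<inter> {x. p x \<le> c})) + vol (hull_relaxation (B \<inter> {x. p x \<ge> c}))"

end

theory Submission
  imports Defs
begin

text \<open>
  After the affine change of coordinates \<open>x\<^sub>i = a\<^sub>i + (b\<^sub>i - a\<^sub>i) t\<^sub>i\<close> and after dropping affine terms, the
  monomial becomes \<open>A t\<^sub>2 t\<^sub>3 + B t\<^sub>1 t\<^sub>3 + C t\<^sub>1 t\<^sub>2 + P t\<^sub>1 t\<^sub>2 t\<^sub>3\<close> on the unit cube, where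
  \<open>A = a\<^sub>1 (b\<^sub>2 - a\<^sub>2) (b\<^sub>3 - a\<^sub>3)\<close>, \<open>B\<close> and \<open>C\<close> are formed in the same way from \<open>a\<^sub>2\<close> and \<open>a\<^sub>3\<close>, and \<open>P\<close> is the
  volume of the box. All coefficients are nonnegative, and the chain of inequalities in
  condition \<open>\<Omega>\<close> is \<open>A \<le> B \<le> C\<close>.

  The convex hull of a multilinear graph over the cube consists of the expectations of the
  function at random vertices with prescribed mean \<open>t\<close>, that is, at triples of 0/1 random variables
  with marginals \<open>t\<^sub>1, t\<^sub>2, t\<^sub>3\<close>. For nonnegative coefficients the largest expectation comes from the
  comonotone coupling, where joint probabilities are minima of the marginals. The smallest one
  comes from a coupling in which the two pairs with the larger coefficients, and the triple, overlap
  as little as possible. This gives explicit envelopes (\<open>convex_hull_cube_graph\<close>).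
  The integral of their difference over the cube is
  \<open>(5 P + 4 (A + B + C) - 2 min {A, B, C}) / 24\<close> (\<open>cube_integral_gap\<close>), and so the hull over the box
  has volume \<open>P\<close> times this number (\<open>vol_hull_relaxation\<close>).

  Splitting the first side in the ratio \<open>s : 1 - s\<close> turns \<open>(P, A, B, C)\<close> into \<open>(s P, A, s B, s C)\<close> and
  \<open>((1 - s) P, A + s P, (1 - s) B, (1 - s) C)\<close>, so the total volume is an explicit function of \<open>s\<close>, the
  \<open>branching_profile\<close>. When one branches on the second or third variable, the unscaled
  coefficient is never the smallest one in either child, so both minima are attained by the scaled
  \<open>A\<close>. The profile is then a quadratic polynomial in \<open>s\<close> with its minimum at the midpoint. All
  comparisons in the theorem thus reduce to linear inequalities between the profiles at the
  midpoint; the minimiser for the first variable is only needed to exist, which is compactness.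
\<close>

section \<open>The convex hull of a trilinear graph over the unit cube\<close>

definition pos_part :: "real \<Rightarrow> real" where "pos_part x = max 0 x"

text \<open>The expectation under the comonotone coupling, where all joint probabilities are minima.
  It is the Lovasz extension of the function on the vertices, which is supermodular.\<close>
definition cube_upper :: "real \<Rightarrow> real \<Rightarrow> real \<Rightarrow> real \<Rightarrow> real \<Rightarrow> real \<Rightarrow> real \<Rightarrow> real" where
  "cube_upper P A B C x y z = A * min y z + B * min x z + C * min x y + P * min x (min y z)"

text \<open>Every pair contributes its least possible joint probability \<open>pos_part (s + t - 1)\<close>, except a
  pair with the smallest coefficient \<open>m\<close>: the three pair probabilities have to add up to at
  least \<open>pos_part (x + y + z - 1) + pos_part (x + y + z - 2)\<close>, and the missing mass is placed on the
  cheapest pair. That lower bound on the sum is Jensen's inequality for the number \<open>n\<close> of events that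
  occur, as \<open>n choose 2 = pos_part (n - 1) + pos_part (n - 2)\<close> for \<open>n \<le> 3\<close>.
  The formula is written so that it does not depend on which pair that is.\<close>
definition cube_lower :: "real \<Rightarrow> real \<Rightarrow> real \<Rightarrow> real \<Rightarrow> real \<Rightarrow> real \<Rightarrow> real \<Rightarrow> real" where
  "cube_lower P A B C x y z = (let m = min A (min B C) in
     m * (pos_part (x + y + z - 1) + pos_part (x + y + z - 2)) +
     (A - m) * pos_part (y + z - 1) + (B - m) * pos_part (x + z - 1) +
     (C - m) * pos_part (x + y - 1) + P * pos_part (x + y + z - 2))"

definition cube_graph :: "real \<Rightarrow> real \<Rightarrow> real \<Rightarrow> real \<Rightarrow> (real \<times> real \<times> real \<times> real) set" where
  "cube_graph P A B C = {(f, x, y, z). f = A * (y * z) + B * (x * z) + C * (x * y) + P * (x * y * z) \<and>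
     x \<in> {0..1} \<and> y \<in> {0..1} \<and> z \<in> {0..1}}"

definition cube_body :: "real \<Rightarrow> real \<Rightarrow> real \<Rightarrow> real \<Rightarrow> (real \<times> real \<times> real \<times> real) set" where
  "cube_body P A B C = {(f, x, y, z). x \<in> {0..1} \<and> y \<in> {0..1} \<and> z \<in> {0..1} \<and>
     cube_lower P A B C x y z \<le> f \<and> f \<le> cube_upper P A B C x y z}"

lemma pos_part_convex:
  assumes "0 \<le> u" "0 \<le> v"
  shows "pos_part (u * s + v * t) \<le> u * pos_part s + v * pos_part t"
  unfolding pos_part_def using assms
  by (intro max.boundedI add_nonneg_nonneg mult_nonneg_nonneg add_mono mult_left_mono) auto

lemma min_concave:
  fixes u v :: real
  assumes "0 \<le> u" "0 \<le> v"
  shows "u * min s s' + v * min t t' \<le> min (u * s + v * t) (u * s' + v * t')"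
  using assms by (intro min.boundedI add_mono mult_left_mono) auto

lemma cube_lower_convex:
  assumes "0 \<le> A" "0 \<le> B" "0 \<le> C" "0 \<le> P" and uv: "0 \<le> u" "0 \<le> v" "u + v = 1"
  shows "cube_lower P A B C (u * x + v * x') (u * y + v * y') (u * z + v * z')
    \<le> u * cube_lower P A B C x y z + v * cube_lower P A B C x' y' z'"
proof -
  define m where "m = min A (min B C)"
  have m: "0 \<le> m" "0 \<le> A - m" "0 \<le> B - m" "0 \<le> C - m" using assms by (auto simp: m_def)
  have v: "v = 1 - u" using uv by simp
  note pc = pos_part_convex[OF uv(1,2)]
  have 1: "pos_part (u * x + v * x' + (u * y + v * y') + (u * z + v * z') - k)
     \<le> u * pos_part (x + y + z - k) + v * pos_part (x' + y' + z' - k)" for k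
    using pc[of "x + y + z - k" "x' + y' + z' - k"] by (simp add: v algebra_simps)
  have 2: "pos_part (u * s + v * s' + (u * t + v * t') - 1)
     \<le> u * pos_part (s + t - 1) + v * pos_part (s' + t' - 1)" for s s' t t'
    using pc[of "s + t - 1" "s' + t' - 1"] by (simp add: v algebra_simps)
  have "cube_lower P A B C (u * x + v * x') (u * y + v * y') (u * z + v * z') \<le>
     m * ((u * pos_part (x + y + z - 1) + v * pos_part (x' + y' + z' - 1)) +
          (u * pos_part (x + y + z - 2) + v * pos_part (x' + y' + z' - 2))) +
     (A - m) * (u * pos_part (y + z - 1) + v * pos_part (y' + z' - 1)) +
     (B - m) * (u * pos_part (x + z - 1) + v * pos_part (x' + z' - 1)) +
     (C - m) * (u * pos_part (x + y - 1) + v * pos_part (x' + y' - 1)) +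
     P * (u * pos_part (x + y + z - 2) + v * pos_part (x' + y' + z' - 2))"
    unfolding cube_lower_def m_def[symmetric] Let_def
    using m assms(4) by (intro add_mono mult_left_mono 1 2)
  also have "\<dots> = u * cube_lower P A B C x y z + v * cube_lower P A B C x' y' z'"
    unfolding cube_lower_def m_def[symmetric] Let_def by (simp add: algebra_simps)
  finally show ?thesis .
qed

lemma cube_upper_concave:
  assumes "0 \<le> A" "0 \<le> B" "0 \<le> C" "0 \<le> P" and uv: "0 \<le> u" "0 \<le> v"
  shows "u * cube_upper P A B C x y z + v * cube_upper P A B C x' y' z' \<le>
    cube_upper P A B C (u * x + v * x') (u * y + v * y') (u * z + v * z')"
proof -
  note mc = min_concave[OF uv]
  have 3: "u * min x (min y z) + v * min x' (min y' z')
     \<le> min (u * x + v * x') (min (u * y + v * y') (u * z + v * z'))"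
    using mc[of x "min y z" x' "min y' z'"] mc[of y z y' z'] by linarith
  have "u * cube_upper P A B C x y z + v * cube_upper P A B C x' y' z' =
    A * (u * min y z + v * min y' z') + B * (u * min x z + v * min x' z') +
    C * (u * min x y + v * min x' y') + P * (u * min x (min y z) + v * min x' (min y' z'))"
    unfolding cube_upper_def by (simp add: algebra_simps)
  also have "\<dots> \<le> cube_upper P A B C (u * x + v * x') (u * y + v * y') (u * z + v * z')"
    unfolding cube_upper_def using assms(1-4) by (intro add_mono mult_left_mono mc 3)
  finally show ?thesis .
qed

lemma convex_cube_body:
  assumes "0 \<le> A" "0 \<le> B" "0 \<le> C" "0 \<le> P"
  shows "convex (cube_body P A B C)"
proof (rule convexI)
  fix p q and u v :: real
  assume pq: "p \<in> cube_body P A B C" "q \<in> cube_body P A B C" and uv: "0 \<le> u" "0 \<le> v" "u + v = 1"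
  obtain f x y z where p: "p = (f, x, y, z)" by (cases p)
  obtain f' x' y' z' where q: "q = (f', x', y', z')" by (cases q)
  have cvx: "u * s + v * t \<in> {0..1}" if "s \<in> {0..1}" "t \<in> {0..1}" for s t :: real
    using that uv convexD[of "{0..1::real}" s t u v] by simp
  have "cube_lower P A B C (u * x + v * x') (u * y + v * y') (u * z + v * z') \<le> u * f + v * f'"
    by (rule order_trans[OF cube_lower_convex[OF assms uv]])
       (use pq uv in \<open>auto simp: p q cube_body_def intro!: add_mono mult_left_mono\<close>)
  moreover have "u * f + v * f' \<le> cube_upper P A B C (u * x + v * x') (u * y + v * y') (u * z + v * z')"
    by (rule order_trans[OF _ cube_upper_concave[OF assms uv(1,2)]])
       (use pq uv in \<open>auto simp: p q cube_body_def intro!: add_mono mult_left_mono\<close>)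
  ultimately show "u *\<^sub>R p + v *\<^sub>R q \<in> cube_body P A B C"
    using pq cvx by (simp add: p q cube_body_def)
qed

lemma prod_le_min_pos_part:
  fixes x y :: real
  assumes "x \<in> {0..1}" "y \<in> {0..1}"
  shows "x * y \<le> min x y" "pos_part (x + y - 1) \<le> x * y"
proof -
  show "x * y \<le> min x y"
    using assms by (simp add: mult_left_le mult_left_le_one_le)
  have "0 \<le> (1 - x) * (1 - y)" using assms by simp
  then have "x + y - 1 \<le> x * y" by (simp add: algebra_simps)
  then show "pos_part (x + y - 1) \<le> x * y"
    using assms by (simp add: pos_part_def)
qed

text \<open>The point \<open>t\<close> of the graph is the expectation under the independent coupling, so the estimates are
  the bounds on joint probabilities of independent events. The bound on all three pairs together
  comes from \<open>(1 - x) (1 - y) (1 - z) \<ge> 0\<close>.\<close>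
lemma cube_graph_subset_body:
  assumes ABC: "0 \<le> A" "0 \<le> B" "0 \<le> C" "0 \<le> P"
  shows "cube_graph P A B C \<subseteq> cube_body P A B C"
proof clarify
  fix f x y z assume "(f, x, y, z) \<in> cube_graph P A B C"
  then have f: "f = A * (y * z) + B * (x * z) + C * (x * y) + P * (x * y * z)"
    and x: "x \<in> {0..1}" and y: "y \<in> {0..1}" and z: "z \<in> {0..1}" by (auto simp: cube_graph_def)
  have xy: "x * y \<in> {0..1}" using x y by (auto simp: mult_le_one)
  note b = prod_le_min_pos_part[OF x y] prod_le_min_pos_part[OF x z] prod_le_min_pos_part[OF y z]
    prod_le_min_pos_part[OF xy z]
  have up: "x * y * z \<le> min x (min y z)" using b(1,7) by simp
  have lo: "pos_part (x + y + z - 2) \<le> x * y * z"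
    using b(2,8) by (simp add: pos_part_def)
  have "0 \<le> (1 - x) * (1 - y) * (1 - z)" using x y z by simp
  then have "x + y + z - 1 + x * y * z \<le> y * z + x * z + x * y" by (simp add: algebra_simps)
  moreover have "0 \<le> x * y * z" "0 \<le> y * z + x * z + x * y" using x y z by simp_all
  ultimately have pairs: "pos_part (x + y + z - 1) + pos_part (x + y + z - 2) \<le> y * z + x * z + x * y"
    using lo unfolding pos_part_def by linarith
  define m where "m = min A (min B C)"
  have m: "0 \<le> m" "0 \<le> A - m" "0 \<le> B - m" "0 \<le> C - m" using assms by (auto simp: m_def)
  have "cube_lower P A B C x y z \<le> m * (y * z + x * z + x * y) + (A - m) * (y * z) +
     (B - m) * (x * z) + (C - m) * (x * y) + P * (x * y * z)"
    unfolding cube_lower_def m_def[symmetric] Let_def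
    by (intro add_mono mult_left_mono[OF pairs] mult_left_mono[OF b(6)] mult_left_mono[OF b(4)]
        mult_left_mono[OF b(2)] mult_left_mono[OF lo] m ABC)
  also have "\<dots> = f" by (simp add: f algebra_simps)
  finally have "cube_lower P A B C x y z \<le> f" .
  moreover have "f \<le> cube_upper P A B C x y z"
    unfolding cube_upper_def f using ABC b up by (intro add_mono mult_left_mono) auto
  ultimately show "(f, x, y, z) \<in> cube_body P A B C" using x y z by (simp add: cube_body_def)
qed

text \<open>Joint probabilities of three events with probabilities \<open>x\<close>, \<open>y\<close>, \<open>z\<close> determine the probabilities
  of the eight atoms by inclusion-exclusion. The assumptions say that the atoms have nonnegative
  weight; the weights then exhibit the point as a convex combination of the eight vertices of the
  graph.\<close>
lemma coupling_in_hull: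
  assumes "0 \<le> q" "q \<le> qyz" "q \<le> qxz" "q \<le> qxy"
    "qxy + qxz \<le> x + q" "qxy + qyz \<le> y + q" "qxz + qyz \<le> z + q"
    "x + y + z + q \<le> 1 + qyz + qxz + qxy"
  shows "(A * qyz + B * qxz + C * qxy + P * q, x, y, z) \<in> convex hull cube_graph P A B C"
proof -
  define w :: "bool \<times> bool \<times> bool \<Rightarrow> real" where
    "w = (\<lambda>(i, j, k).
       if i then if j then if k then q else qxy - q else if k then qxz - q else x - qxy - qxz + q
       else if j then if k then qyz - q else y - qxy - qyz + q
            else if k then z - qxz - qyz + q else 1 - x - y - z + qyz + qxz + qxy - q)"
  define corner :: "bool \<times> bool \<times> bool \<Rightarrow> real \<times> real \<times> real \<times> real" where
    "corner = (\<lambda>(i, j, k). (A * (of_bool j * of_bool k) + B * (of_bool i * of_bool k) +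
       C * (of_bool i * of_bool j) + P * (of_bool i * of_bool j * of_bool k),
       of_bool i, of_bool j, of_bool k))"
  have sum_corners: "sum h UNIV = (\<Sum>i\<in>UNIV. \<Sum>j\<in>UNIV. \<Sum>k\<in>UNIV. h (i, j, k))"
    for h :: "bool \<times> bool \<times> bool \<Rightarrow> 'z::comm_monoid_add"
    by (simp add: UNIV_Times_UNIV[symmetric] sum.cartesian_product del: UNIV_Times_UNIV)
  have "(\<Sum>v\<in>UNIV. w v *\<^sub>R corner v) \<in> convex hull cube_graph P A B C"
  proof (rule convex_sum)
    show "sum w UNIV = 1" by (simp add: sum_corners UNIV_bool w_def)
    show "0 \<le> w v" for v using assms by (auto simp: w_def split: prod.split)
    show "corner v \<in> convex hull cube_graph P A B C" for v
      by (rule hull_inc) (auto simp: corner_def cube_graph_def split: prod.split)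
  qed auto
  also have "(\<Sum>v\<in>UNIV. w v *\<^sub>R corner v) = (A * qyz + B * qxz + C * qxy + P * q, x, y, z)"
    by (simp add: sum_corners UNIV_bool w_def corner_def algebra_simps)
  finally show ?thesis .
qed

lemma cube_upper_in_hull:
  assumes "x \<in> {0..1}" "y \<in> {0..1}" "z \<in> {0..1}"
  shows "(cube_upper P A B C x y z, x, y, z) \<in> convex hull cube_graph P A B C"
  unfolding cube_upper_def
  by (rule coupling_in_hull) (use assms in \<open>auto simp: min_def\<close>)

text \<open>For each possible smallest coefficient there is a coupling that attains the lower bound: the
  other two pairs and the triple get their minimal probability, and the cheapest pair gets what
  remains of \<open>E\<close>, the minimal sum of the three pair probabilities.\<close>
lemma cube_lower_in_hull:
  assumes "x \<in> {0..1}" "y \<in> {0..1}" "z \<in> {0..1}"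
  shows "(cube_lower P A B C x y z, x, y, z) \<in> convex hull cube_graph P A B C"
proof -
  define qxy where "qxy = pos_part (x + y - 1)"
  define qxz where "qxz = pos_part (x + z - 1)"
  define qyz where "qyz = pos_part (y + z - 1)"
  define q where "q = pos_part (x + y + z - 2)"
  define E where "E = pos_part (x + y + z - 1) + q"
  note defs = qxy_def qxz_def qyz_def q_def E_def pos_part_def
  consider "A \<le> B" "A \<le> C" | "B \<le> A" "B \<le> C" | "C \<le> A" "C \<le> B" by linarith
  then show ?thesis
  proof cases
    case 1
    then have "cube_lower P A B C x y z = A * (E - qxz - qxy) + B * qxz + C * qxy + P * q"
      unfolding cube_lower_def Let_def
      by (simp add: min_def flip: qxy_def qxz_def qyz_def q_def E_def) (simp add: algebra_simps E_def)
    also have "(\<dots>, x, y, z) \<in> convex hull cube_graph P A B C"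
      by (rule coupling_in_hull) (use assms in \<open>auto simp: defs max_def\<close>)
    finally show ?thesis .
  next
    case 2
    then have "cube_lower P A B C x y z = A * qyz + B * (E - qyz - qxy) + C * qxy + P * q"
      unfolding cube_lower_def Let_def
      by (simp add: min_def flip: qxy_def qxz_def qyz_def q_def E_def) (simp add: algebra_simps E_def)
    also have "(\<dots>, x, y, z) \<in> convex hull cube_graph P A B C"
      by (rule coupling_in_hull) (use assms in \<open>auto simp: defs max_def\<close>)
    finally show ?thesis .
  next
    case 3
    then have "cube_lower P A B C x y z = A * qyz + B * qxz + C * (E - qyz - qxz) + P * q"
      unfolding cube_lower_def Let_def
      by (simp add: min_def flip: qxy_def qxz_def qyz_def q_def E_def) (simp add: algebra_simps E_def)
    also have "(\<dots>, x, y, z) \<in> convex hull cube_graph P A B C"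
      by (rule coupling_in_hull) (use assms in \<open>auto simp: defs max_def\<close>)
    finally show ?thesis .
  qed
qed

theorem convex_hull_cube_graph:
  assumes "0 \<le> A" "0 \<le> B" "0 \<le> C" "0 \<le> P"
  shows "convex hull cube_graph P A B C = cube_body P A B C"
proof
  show "convex hull cube_graph P A B C \<subseteq> cube_body P A B C"
    using cube_graph_subset_body[OF assms] convex_cube_body[OF assms] by (rule hull_minimal)
  show "cube_body P A B C \<subseteq> convex hull cube_graph P A B C"
  proof clarify
    fix f x y z assume "(f, x, y, z) \<in> cube_body P A B C"
    then have xyz: "x \<in> {0..1}" "y \<in> {0..1}" "z \<in> {0..1}"
      and f: "f \<in> closed_segment (cube_lower P A B C x y z) (cube_upper P A B C x y z)"
      by (auto simp: cube_body_def closed_segment_eq_real_ivl)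
    obtain u where u: "0 \<le> u" "u \<le> 1"
      "f = (1 - u) *\<^sub>R cube_lower P A B C x y z + u *\<^sub>R cube_upper P A B C x y z"
      using f unfolding closed_segment_def by blast
    have "(1 - u) *\<^sub>R (cube_lower P A B C x y z, x, y, z) + u *\<^sub>R (cube_upper P A B C x y z, x, y, z)
        \<in> convex hull cube_graph P A B C"
      using u by (intro convexD[OF convex_convex_hull] cube_lower_in_hull cube_upper_in_hull xyz) auto
    then show "(f, x, y, z) \<in> convex hull cube_graph P A B C"
      by (simp add: u algebra_simps)
  qed
qed

section \<open>Volumes between graphs and iterated integrals\<close>

text \<open>The function value is the first component of the product, so Fubini is applied with the second
  component as the outer variable.\<close>
lemma measure_between_graphs:
  fixes L U :: "'a::euclidean_space \<Rightarrow> real"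
  assumes L: "continuous_on UNIV L" and U: "continuous_on UNIV U"
    and le: "\<And>x. x \<in> cbox a b \<Longrightarrow> L x \<le> U x"
  shows "measure lebesgue {(f, x). x \<in> cbox a b \<and> L x \<le> f \<and> f \<le> U x} =
    integral (cbox a b) (\<lambda>x. U x - L x)" (is "measure lebesgue ?S = integral _ ?gap")
proof -
  have snd: "continuous_on UNIV (\<lambda>p::real \<times> 'a. h (snd p))" if "continuous_on UNIV h" for h :: "'a \<Rightarrow> real"
    using that by (rule continuous_on_compose2) (auto intro: continuous_intros)
  have "?S = {p. snd p \<in> cbox a b} \<inter> {p. L (snd p) \<le> fst p} \<inter> {p. fst p \<le> U (snd p)}"
    by auto
  also have "closed \<dots>"
    by (intro closed_Int closed_Collect_le snd L U continuous_intros closed_vimage[of "cbox a b" snd, unfolded vimage_def])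
      auto
  finally have S: "?S \<in> sets borel" by (rule borel_closed)
  then have S': "?S \<in> sets (lborel \<Otimes>\<^sub>M lborel)" unfolding lborel_prod by simp
  have gap: "?gap integrable_on cbox a b"
    using L U by (intro integrable_continuous continuous_on_diff) (auto intro: continuous_on_subset)
  have slice: "emeasure lborel ((\<lambda>f. (f, x)) -` ?S) = ennreal (?gap x * indicator (cbox a b) x)" for x
  proof (cases "x \<in> cbox a b")
    case True
    then have "(\<lambda>f. (f, x)) -` ?S = {L x..U x}" by auto
    then show ?thesis using True le by simp
  qed (simp add: vimage_def)
  have "emeasure lborel ?S = (\<integral>\<^sup>+x. ennreal (?gap x * indicator (cbox a b) x) \<partial>lborel)"
    using lborel_pair.emeasure_pair_measure_alt2[OF S'] unfolding lborel_prod slice .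
  also have "\<dots> = ennreal (integral (cbox a b) ?gap)"
  proof (rule nn_integral_has_integral_lborel)
    show "(\<lambda>x. ?gap x * indicator (cbox a b) x) \<in> borel_measurable borel"
      using L U by (intro borel_measurable_times borel_measurable_diff borel_measurable_indicator)
        (auto intro: borel_measurable_continuous_onI)
    have "(\<lambda>x. ?gap x * indicator (cbox a b) x) = (\<lambda>x. if x \<in> cbox a b then ?gap x else 0)"
      by (auto simp: indicator_def)
    then show "((\<lambda>x. ?gap x * indicator (cbox a b) x) has_integral integral (cbox a b) ?gap) UNIV"
      using integrable_integral[OF gap] by (simp only: has_integral_restrict_UNIV)
  qed (use le in \<open>auto simp: indicator_def\<close>)
  finally have "emeasure lborel ?S = ennreal (integral (cbox a b) ?gap)" .
  moreover have "0 \<le> integral (cbox a b) ?gap"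
    using gap le by (intro integral_nonneg) auto
  ultimately show ?thesis
    using S by (simp add: measure_def)
qed

lemma integral_unit_interval_rescale:
  fixes g :: "real \<Rightarrow> real"
  assumes "continuous_on UNIV g" "a < b"
  shows "integral {a..b} (\<lambda>x. g ((x - a) / (b - a))) = (b - a) * integral {0..1} g"
proof -
  have "(g has_integral integral {0..1} g) {0..1}"
    using continuous_on_subset[OF assms(1)] by (intro integrable_integral integrable_continuous_interval) auto
  then have "((\<lambda>x. g (inverse (b - a) *\<^sub>R x + - a / (b - a))) has_integral
      integral {0..1} g /\<^sub>R inverse (b - a))
      (cbox ((0 - - a / (b - a)) /\<^sub>R inverse (b - a)) ((1 - - a / (b - a)) /\<^sub>R inverse (b - a)))"
    using has_integral_affinity'[of g _ 0 1 "inverse (b - a)" "- a / (b - a)"] assms by simp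
  moreover have "(0 - - a / (b - a)) /\<^sub>R inverse (b - a) = a" "(1 - - a / (b - a)) /\<^sub>R inverse (b - a) = b"
    using assms by (simp_all add: distrib_left)
  moreover have "inverse (b - a) *\<^sub>R x + - a / (b - a) = (x - a) / (b - a)" for x
    by (simp add: divide_inverse algebra_simps)
  ultimately have "((\<lambda>x. g ((x - a) / (b - a))) has_integral (b - a) * integral {0..1} g) {a..b}"
    by (simp add: mult.commute)
  then show ?thesis by (rule integral_unique)
qed

lemma integral_box3:
  fixes f :: "real \<times> real \<times> real \<Rightarrow> real"
  assumes f: "continuous_on UNIV f"
  shows "integral (cbox (a1, a2, a3) (b1, b2, b3)) f =
    integral {a1..b1} (\<lambda>x. integral {a2..b2} (\<lambda>y. integral {a3..b3} (\<lambda>z. f (x, y, z))))"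
proof -
  have "integral (cbox (a2, a3) (b2, b3)) (\<lambda>p. f (x, p)) =
     integral {a2..b2} (\<lambda>y. integral {a3..b3} (\<lambda>z. f (x, y, z)))" for x
    by (subst integral_prod_continuous)
      (auto intro!: continuous_on_compose2[OF f] continuous_intros)
  then show ?thesis
    by (subst integral_prod_continuous) (auto intro: continuous_on_subset[OF f])
qed

lemma continuous_integral_parameter:
  fixes f :: "'a::euclidean_space \<times> real \<Rightarrow> real"
  assumes f: "continuous_on UNIV f"
  shows "continuous_on UNIV (\<lambda>p. integral {a..b} (\<lambda>z. f (p, z)))"
proof -
  have "continuous_on (UNIV \<times> cbox a b) (\<lambda>(p, z). f (p, z))"
    using f by (auto intro: continuous_on_subset)
  from integral_continuous_on_param[OF this] show ?thesis by simp
qed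

lemma integral_unit_cube_rescale:
  fixes f :: "real \<times> real \<times> real \<Rightarrow> real"
  assumes f: "continuous_on UNIV f" and lt: "a1 < b1" "a2 < b2" "a3 < b3"
  shows "integral (cbox (a1, a2, a3) (b1, b2, b3))
      (\<lambda>(x, y, z). f ((x - a1) / (b1 - a1), (y - a2) / (b2 - a2), (z - a3) / (b3 - a3))) =
    (b1 - a1) * (b2 - a2) * (b3 - a3) * integral (cbox (0, 0, 0) (1, 1, 1)) f"
proof -
  define F2 where "F2 x y = integral {0..1} (\<lambda>z. f (x, y, z))" for x y
  define F1 where "F1 x = integral {0..1} (\<lambda>y. F2 x y)" for x
  have c3: "continuous_on UNIV (\<lambda>z. f (x, y, z))" for x y
    by (intro continuous_on_compose2[OF f] continuous_intros) auto
  have c2': "continuous_on UNIV (\<lambda>p. F2 (fst p) (snd p))"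
    unfolding F2_def
    by (rule continuous_integral_parameter[where f = "\<lambda>q. f (fst (fst q), snd (fst q), snd q)", simplified])
      (intro continuous_on_compose2[OF f] continuous_intros, auto)
  then have c2: "continuous_on UNIV (\<lambda>y. F2 x y)" for x
    using continuous_on_compose2[OF c2', of UNIV "\<lambda>y. (x, y)"] by (simp add: continuous_intros)
  have c1: "continuous_on UNIV F1"
    unfolding F1_def
    using continuous_integral_parameter[where f = "\<lambda>p. F2 (fst p) (snd p)", OF c2'] by simp
  have cc: "continuous_on UNIV (\<lambda>(x, y, z). f ((x - a1) / (b1 - a1), (y - a2) / (b2 - a2), (z - a3) / (b3 - a3)))"
    unfolding case_prod_unfold using lt
    by (intro continuous_on_compose2[OF f] continuous_intros) auto
  show ?thesis
    using lt integral_unit_interval_rescale[OF c3 lt(3)] integral_unit_interval_rescale[OF c2 lt(2)]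
      integral_unit_interval_rescale[OF c1 lt(1)]
    by (simp add: integral_box3[OF f] integral_box3[OF cc] flip: F2_def F1_def)
qed

section \<open>The volume between the envelopes over the unit cube\<close>

text \<open>All integrands below are polynomials in truncated linear forms, because
  \<open>min s t = t - pos_part (t - s)\<close>. This one formula therefore serves for every inner and middle
  integral. The kink at \<open>- c\<close> is harmless, since the antiderivative is continuous there.\<close>
lemma pos_part_power_integral:
  assumes "0 < k"
  shows "((\<lambda>t. pos_part (t + c) ^ k) has_integral
    (pos_part (1 + c) ^ Suc k - pos_part c ^ Suc k) / (real (Suc k))) {0..1}"
proof -
  let ?F = "\<lambda>t. pos_part (t + c) ^ Suc k / (real (Suc k))"
  have cont: "continuous_on {0..1} ?F"
    unfolding pos_part_def by (intro continuous_intros) auto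
  have deriv: "(?F has_vector_derivative pos_part (t + c) ^ k) (at t)" if "t \<noteq> - c" for t
  proof (cases "t < - c")
    case True
    have "(?F has_real_derivative 0) (at t)"
      by (rule has_field_derivative_transform_within_open[of "\<lambda>t. 0" _ _ "{..<- c}"])
        (use True in \<open>auto simp: pos_part_def\<close>)
    moreover have "pos_part (t + c) ^ k = 0" using True assms by (simp add: pos_part_def)
    ultimately show ?thesis by (simp only: has_real_derivative_iff_has_vector_derivative)
  next
    case False
    have "((\<lambda>t. (t + c) ^ Suc k) has_real_derivative real (Suc k) * (t + c) ^ k) (at t)"
      by (auto intro!: derivative_eq_intros simp del: power_Suc)
    from DERIV_cdivide[OF this, of "real (Suc k)"]
    have "((\<lambda>t. (t + c) ^ Suc k / real (Suc k)) has_real_derivative (t + c) ^ k) (at t)"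
      by (simp del: power_Suc of_nat_Suc)
    then have "(?F has_real_derivative (t + c) ^ k) (at t)"
      by (rule has_field_derivative_transform_within_open[of _ _ _ "{- c<..}"])
        (use False that in \<open>auto simp: pos_part_def\<close>)
    moreover have "pos_part (t + c) = t + c" using False by (simp add: pos_part_def)
    ultimately show ?thesis by (simp only: has_real_derivative_iff_has_vector_derivative)
  qed
  have "((\<lambda>t. pos_part (t + c) ^ k) has_integral (?F 1 - ?F 0)) {0..1}"
    by (rule fundamental_theorem_of_calculus_interior_strong[of "{- c}"])
      (use cont deriv in \<open>simp_all del: power_Suc of_nat_Suc\<close>)
  then show ?thesis by (simp add: diff_divide_distrib)
qed

lemma power_integral:
  assumes "0 < k"
  shows "((\<lambda>t. t ^ k) has_integral 1 / (real (Suc k))) {0..1::real}"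
proof -
  have "((\<lambda>t. pos_part (t + 0) ^ k) has_integral 1 / (real (Suc k))) {0..1}"
    using pos_part_power_integral[OF assms, of 0] by (simp add: pos_part_def)
  then show ?thesis by (rule has_integral_eq[rotated]) (simp add: pos_part_def)
qed

text \<open>The inner and middle integrals are only known for parameters in the unit interval, where
  truncations such as \<open>pos_part x\<close> simplify.\<close>
lemma cube_has_integral:
  fixes f :: "real \<times> real \<times> real \<Rightarrow> real"
  assumes f: "continuous_on UNIV f"
    and g: "\<And>x y. x \<in> {0..1} \<Longrightarrow> y \<in> {0..1} \<Longrightarrow> ((\<lambda>z. f (x, y, z)) has_integral g x y) {0..1}"
    and h: "\<And>x. x \<in> {0..1} \<Longrightarrow> (g x has_integral h x) {0..1}"
    and v: "(h has_integral v) {0..1}"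
  shows "(f has_integral v) (cbox (0, 0, 0) (1, 1, 1))"
proof -
  have "integral (cbox (0, 0, 0) (1, 1, 1)) f =
      integral {0..1} (\<lambda>x. integral {0..1} (\<lambda>y. integral {0..1} (\<lambda>z. f (x, y, z))))"
    by (rule integral_box3[OF f])
  also have "\<dots> = integral {0..1} (\<lambda>x. integral {0..1} (g x))"
    using g by (intro integral_cong) (auto intro!: integral_cong integral_unique)
  also have "\<dots> = integral {0..1} h"
    using h by (intro integral_cong) (auto intro!: integral_unique)
  also have "\<dots> = v" using v by (rule integral_unique)
  finally show ?thesis
    using integrable_integral[OF integrable_continuous[OF continuous_on_subset[OF f]], of "(0, 0, 0)" "(1, 1, 1)"]
    by simp
qed

lemma const_integral: "((\<lambda>t. c) has_integral c) {0..1::real}" for c :: real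
  using has_integral_const_real[of c 0 1] by simp

lemma min_eq_pos_part: "min s t = t - pos_part (t - s)" for s t :: real
  by (simp add: pos_part_def)

lemma min_integral:
  assumes "s \<in> {0..1}"
  shows "((\<lambda>t. min s t) has_integral s - s\<^sup>2 / 2) {0..1::real}"
proof -
  have "((\<lambda>t. t ^ 1 - pos_part (t + - s) ^ 1) has_integral
     1 / real (Suc 1) - (pos_part (1 + - s) ^ Suc 1 - pos_part (- s) ^ Suc 1) / real (Suc 1)) {0..1}"
    by (intro has_integral_diff power_integral pos_part_power_integral) auto
  moreover have "1 / real (Suc 1) - (pos_part (1 + - s) ^ Suc 1 - pos_part (- s) ^ Suc 1) / real (Suc 1) = s - s\<^sup>2 / 2"
    using assms by (simp add: pos_part_def power2_eq_square field_simps)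
  ultimately show ?thesis by (simp add: min_eq_pos_part)
qed

lemma pos_part_integral:
  assumes "s \<in> {0..1}"
  shows "((\<lambda>t. pos_part (s + t - 1)) has_integral s\<^sup>2 / 2) {0..1::real}"
proof -
  have "((\<lambda>t. pos_part (t + (s - 1)) ^ 1) has_integral s\<^sup>2 / 2) {0..1}"
    using pos_part_power_integral[of 1 "s - 1"] assms by (simp add: pos_part_def power2_eq_square)
  then show ?thesis by (simp add: algebra_simps)
qed

lemma quadratic_integrals:
  shows "((\<lambda>s. s - s\<^sup>2 / 2) has_integral 1 / 3) {0..1::real}"
    and "((\<lambda>s. s\<^sup>2 / 2) has_integral 1 / 6) {0..1::real}"
  using has_integral_diff[OF power_integral[of 1] has_integral_divide[OF power_integral[of 2], of 2]]
    has_integral_divide[OF power_integral[of 2], of 2] by simp_all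

lemma continuous_pos_part [continuous_intros]:
  "continuous_on S f \<Longrightarrow> continuous_on S (\<lambda>x. pos_part (f x))"
  unfolding pos_part_def by (intro continuous_intros)

lemma cube_integral_min_pair:
  shows "((\<lambda>(x, y, z). min y z) has_integral 1 / 3) (cbox (0, 0, 0) (1 :: real, 1 :: real, 1 :: real))"
    and "((\<lambda>(x, y, z). min x z) has_integral 1 / 3) (cbox (0, 0, 0) (1 :: real, 1 :: real, 1 :: real))"
    and "((\<lambda>(x, y, z). min x y) has_integral 1 / 3) (cbox (0, 0, 0) (1 :: real, 1 :: real, 1 :: real))"
proof -
  show "((\<lambda>(x, y, z). min y z) has_integral 1 / 3) (cbox (0, 0, 0) (1 :: real, 1 :: real, 1 :: real))"
    by (rule cube_has_integral[where g = "\<lambda>x y. y - y\<^sup>2 / 2" and h = "\<lambda>x. 1 / 3"])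
      (auto simp: case_prod_unfold intro!: continuous_intros min_integral const_integral quadratic_integrals)
  show "((\<lambda>(x, y, z). min x z) has_integral 1 / 3) (cbox (0, 0, 0) (1 :: real, 1 :: real, 1 :: real))"
    by (rule cube_has_integral[where g = "\<lambda>x y. x - x\<^sup>2 / 2" and h = "\<lambda>x. x - x\<^sup>2 / 2"])
      (auto simp: case_prod_unfold intro!: continuous_intros min_integral const_integral quadratic_integrals)
  show "((\<lambda>(x, y, z). min x y) has_integral 1 / 3) (cbox (0, 0, 0) (1 :: real, 1 :: real, 1 :: real))"
    by (rule cube_has_integral[where g = "\<lambda>x y. min x y" and h = "\<lambda>x. x - x\<^sup>2 / 2"])
      (auto simp: case_prod_unfold intro!: continuous_intros min_integral const_integral quadratic_integrals)
qed

lemma cube_integral_pos_part_pair: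
  shows "((\<lambda>(x, y, z). pos_part (y + z - 1)) has_integral 1 / 6) (cbox (0, 0, 0) (1 :: real, 1 :: real, 1 :: real))"
    and "((\<lambda>(x, y, z). pos_part (x + z - 1)) has_integral 1 / 6) (cbox (0, 0, 0) (1 :: real, 1 :: real, 1 :: real))"
    and "((\<lambda>(x, y, z). pos_part (x + y - 1)) has_integral 1 / 6) (cbox (0, 0, 0) (1 :: real, 1 :: real, 1 :: real))"
proof -
  show "((\<lambda>(x, y, z). pos_part (y + z - 1)) has_integral 1 / 6) (cbox (0, 0, 0) (1 :: real, 1 :: real, 1 :: real))"
    by (rule cube_has_integral[where g = "\<lambda>x y. y\<^sup>2 / 2" and h = "\<lambda>x. 1 / 6"])
      (auto simp: case_prod_unfold intro!: continuous_intros pos_part_integral const_integral quadratic_integrals)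
  show "((\<lambda>(x, y, z). pos_part (x + z - 1)) has_integral 1 / 6) (cbox (0, 0, 0) (1 :: real, 1 :: real, 1 :: real))"
    by (rule cube_has_integral[where g = "\<lambda>x y. x\<^sup>2 / 2" and h = "\<lambda>x. x\<^sup>2 / 2"])
      (auto simp: case_prod_unfold intro!: continuous_intros pos_part_integral const_integral quadratic_integrals)
  show "((\<lambda>(x, y, z). pos_part (x + y - 1)) has_integral 1 / 6) (cbox (0, 0, 0) (1 :: real, 1 :: real, 1 :: real))"
    by (rule cube_has_integral[where g = "\<lambda>x y. pos_part (x + y - 1)" and h = "\<lambda>x. x\<^sup>2 / 2"])
      (auto simp: case_prod_unfold intro!: continuous_intros pos_part_integral const_integral quadratic_integrals)
qed

lemma cube_integral_pos_part_sum_1: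
  "((\<lambda>(x, y, z). pos_part (x + y + z - 1)) has_integral 13 / 24) (cbox (0, 0, 0) (1 :: real, 1 :: real, 1 :: real))"
proof (rule cube_has_integral)
  show "((\<lambda>z. (\<lambda>(x, y, z). pos_part (x + y + z - 1)) (x, y, z)) has_integral
      (pos_part (y + x) ^ 2 - pos_part (y + (x - 1)) ^ 2) / 2) {0..1}" for x y
    using pos_part_power_integral[of 1 "x + y - 1"] by (simp add: algebra_simps power2_eq_square)
  show "((\<lambda>y. (pos_part (y + x) ^ 2 - pos_part (y + (x - 1)) ^ 2) / 2) has_integral
      ((1 + 3 * x ^ 1 + 3 * x ^ 2 - x ^ 3) / 6)) {0..1}" if "x \<in> {0..1}" for x
  proof -
    have "((\<lambda>y. (pos_part (y + x) ^ 2 - pos_part (y + (x - 1)) ^ 2) / 2) has_integral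
      ((pos_part (1 + x) ^ Suc 2 - pos_part x ^ Suc 2) / real (Suc 2) -
       (pos_part (1 + (x - 1)) ^ Suc 2 - pos_part (x - 1) ^ Suc 2) / real (Suc 2)) / 2) {0..1}"
      by (intro has_integral_divide has_integral_diff pos_part_power_integral) auto
    then show ?thesis
      by (rule back_subst[of "\<lambda>v. (_ has_integral v) _"])
        (use that in \<open>simp add: pos_part_def power3_eq_cube power2_eq_square field_simps\<close>)
  qed
  have "((\<lambda>x. (1 + 3 * x ^ 1 + 3 * x ^ 2 - x ^ 3) / 6) has_integral
     (1 + 3 * (1 / real (Suc 1)) + 3 * (1 / real (Suc 2)) - 1 / real (Suc 3)) / 6) {0..1::real}"
    by (intro has_integral_divide has_integral_diff has_integral_add has_integral_mult_right
        power_integral const_integral) auto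
  then show "((\<lambda>x. (1 + 3 * x ^ 1 + 3 * x ^ 2 - x ^ 3) / 6) has_integral 13 / 24) {0..1::real}"
    by simp
qed (auto simp: case_prod_unfold intro!: continuous_intros)

lemma cube_integral_pos_part_sum_2:
  "((\<lambda>(x, y, z). pos_part (x + y + z - 2)) has_integral 1 / 24) (cbox (0, 0, 0) (1 :: real, 1 :: real, 1 :: real))"
proof (rule cube_has_integral)
  show "((\<lambda>z. (\<lambda>(x, y, z). pos_part (x + y + z - 2)) (x, y, z)) has_integral
      pos_part (y + (x - 1)) ^ 2 / 2) {0..1}" if "x \<in> {0..1}" "y \<in> {0..1}" for x y
    using pos_part_power_integral[of 1 "x + y - 2"] that
    by (simp add: algebra_simps power2_eq_square pos_part_def)
  show "((\<lambda>y. pos_part (y + (x - 1)) ^ 2 / 2) has_integral x ^ 3 / 6) {0..1}" if "x \<in> {0..1}" for x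
    using has_integral_divide[OF pos_part_power_integral[of 2 "x - 1"], of 2] that
    by (simp add: pos_part_def eval_nat_numeral)
  show "((\<lambda>x. x ^ 3 / 6) has_integral 1 / 24) {0..1::real}"
    using has_integral_divide[OF power_integral[of 3], of 6] by simp
qed (auto simp: case_prod_unfold intro!: continuous_intros)

lemma cube_integral_min_triple:
  "((\<lambda>(x, y, z). min x (min y z)) has_integral 1 / 4) (cbox (0, 0, 0) (1 :: real, 1 :: real, 1 :: real))"
proof (rule cube_has_integral)
  \<comment> \<open>The inner integral is \<open>w - w\<^sup>2 / 2\<close> for \<open>w = min x y\<close>, expanded in powers of \<open>pos_part (y - x)\<close> using
    \<open>y * pos_part (y - x) = x * pos_part (y - x) + (pos_part (y - x))\<^sup>2\<close>. The exponents 1 keep every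
    summand in the form that the integrals of powers expect.\<close>
  show "((\<lambda>z. (\<lambda>(x, y, z). min x (min y z)) (x, y, z)) has_integral
      y ^ 1 - pos_part (y + - x) ^ 1 - y ^ 2 / 2 + x * pos_part (y + - x) ^ 1 + pos_part (y + - x) ^ 2 / 2) {0..1}"
    if "x \<in> {0..1}" "y \<in> {0..1}" for x y :: real
  proof -
    have "y ^ 1 - pos_part (y + - x) ^ 1 - y ^ 2 / 2 + x * pos_part (y + - x) ^ 1 + pos_part (y + - x) ^ 2 / 2
        = min x y - (min x y)\<^sup>2 / 2"
      by (cases "x \<le> y") (simp_all add: pos_part_def power2_eq_square field_simps)
    moreover have "min x y \<in> {0..1}" using that by (simp add: min_le_iff_disj)
    ultimately show ?thesis using min_integral[of "min x y"] by (simp add: min.assoc)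
  qed
  show "((\<lambda>y. y ^ 1 - pos_part (y + - x) ^ 1 - y ^ 2 / 2 + x * pos_part (y + - x) ^ 1 + pos_part (y + - x) ^ 2 / 2)
      has_integral x ^ 1 - x ^ 2 + x ^ 3 / 3) {0..1}" if "x \<in> {0..1}" for x
  proof -
    have "((\<lambda>y. y ^ 1 - pos_part (y + - x) ^ 1 - y ^ 2 / 2 + x * pos_part (y + - x) ^ 1 + pos_part (y + - x) ^ 2 / 2)
      has_integral 1 / real (Suc 1) - (pos_part (1 + - x) ^ Suc 1 - pos_part (- x) ^ Suc 1) / real (Suc 1)
        - 1 / real (Suc 2) / 2
        + x * ((pos_part (1 + - x) ^ Suc 1 - pos_part (- x) ^ Suc 1) / real (Suc 1))
        + (pos_part (1 + - x) ^ Suc 2 - pos_part (- x) ^ Suc 2) / real (Suc 2) / 2) {0..1}"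
      by (intro has_integral_divide has_integral_diff has_integral_add has_integral_mult_right
          pos_part_power_integral power_integral) auto
    then show ?thesis
      by (rule back_subst[of "\<lambda>v. (_ has_integral v) _"])
        (use that in \<open>simp add: pos_part_def power3_eq_cube power2_eq_square field_simps\<close>)
  qed
  have "((\<lambda>x. x ^ 1 - x ^ 2 + x ^ 3 / 3) has_integral
     1 / real (Suc 1) - 1 / real (Suc 2) + 1 / real (Suc 3) / 3) {0..1::real}"
    by (intro has_integral_divide has_integral_diff has_integral_add power_integral) auto
  then show "((\<lambda>x. x ^ 1 - x ^ 2 + x ^ 3 / 3) has_integral 1 / 4) {0..1::real}" by simp
qed (auto simp: case_prod_unfold intro!: continuous_intros)

lemma cube_integral_gap:
  "((\<lambda>(x, y, z). cube_upper P A B C x y z - cube_lower P A B C x y z) has_integral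
     (5 * P + 4 * (A + B + C) - 2 * min A (min B C)) / 24) (cbox (0, 0, 0) (1, 1, 1))"
proof -
  define m where "m = min A (min B C)"
  note i = cube_integral_min_pair[unfolded case_prod_unfold] cube_integral_min_triple[unfolded case_prod_unfold]
    cube_integral_pos_part_pair[unfolded case_prod_unfold]
    cube_integral_pos_part_sum_1[unfolded case_prod_unfold] cube_integral_pos_part_sum_2[unfolded case_prod_unfold]
  show ?thesis
    unfolding case_prod_unfold cube_upper_def cube_lower_def Let_def m_def[symmetric]
    by (rule has_integral_eq_rhs, (rule has_integral_diff has_integral_add has_integral_mult_right i)+)
      (simp add: field_simps)
qed

section \<open>The volume of the relaxation over a box\<close>

text \<open>The parameters are the volume \<open>P\<close> of the box and the coefficients of the three bilinear terms
  over the unit cube. In this form there are no divisions by side lengths, so degenerate boxes,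
  which arise when branching at an end point, are covered.\<close>
definition box_relaxation_volume :: "real \<Rightarrow> real \<Rightarrow> real \<Rightarrow> real \<Rightarrow> real" where
  "box_relaxation_volume P A B C = P * (5 * P + 4 * (A + B + C) - 2 * min A (min B C)) / 24"

lemma interpolation_in_interval:
  fixes a b t :: real
  assumes "t \<in> {0..1}" "a < b"
  shows "a + (b - a) * t \<in> {a..b}"
proof -
  have "a + 0 \<le> a + (b - a) * t" "a + (b - a) * t \<le> a + (b - a) * 1"
    using assms by (intro add_left_mono mult_nonneg_nonneg mult_left_mono; simp)+
  then show ?thesis by simp
qed

lemma continuous_cube_bounds:
  assumes "continuous_on S f" "continuous_on S g" "continuous_on S h"
  shows "continuous_on S (\<lambda>p. cube_upper P A B C (f p) (g p) (h p))"
    and "continuous_on S (\<lambda>p. cube_lower P A B C (f p) (g p) (h p))"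
  unfolding cube_upper_def cube_lower_def Let_def by (intro continuous_intros assms)+

text \<open>The affine part of the monomial is split off and becomes a shear of the function value.\<close>
definition cube_to_box :: "real \<Rightarrow> real \<Rightarrow> real \<Rightarrow> real \<Rightarrow> real \<Rightarrow> real \<Rightarrow>
    real \<times> real \<times> real \<times> real \<Rightarrow> real \<times> real \<times> real \<times> real" where
  "cube_to_box a1 b1 a2 b2 a3 b3 = (\<lambda>(f, x, y, z).
     (a1 * a2 * a3 + (b1 - a1) * a2 * a3 * x + a1 * (b2 - a2) * a3 * y + a1 * a2 * (b3 - a3) * z + f,
      a1 + (b1 - a1) * x, a2 + (b2 - a2) * y, a3 + (b3 - a3) * z))"

lemma hull_relaxation_eq_affine_image:
  assumes lt: "a1 < b1" "a2 < b2" "a3 < b3"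
    and P: "P = (b1 - a1) * (b2 - a2) * (b3 - a3)"
    and A: "A = a1 * (b2 - a2) * (b3 - a3)" and B: "B = (b1 - a1) * a2 * (b3 - a3)"
    and C: "C = (b1 - a1) * (b2 - a2) * a3"
  shows "hull_relaxation ({a1..b1} \<times> {a2..b2} \<times> {a3..b3}) =
    cube_to_box a1 b1 a2 b2 a3 b3 ` (convex hull cube_graph P A B C)"
proof -
  let ?\<Phi> = "cube_to_box a1 b1 a2 b2 a3 b3"
  let ?\<Psi> = "\<lambda>(f, x, y, z). ((b1 - a1) * a2 * a3 * x + a1 * (b2 - a2) * a3 * y + a1 * a2 * (b3 - a3) * z + f,
       (b1 - a1) * x, (b2 - a2) * y, (b3 - a3) * z)"
  have split: "?\<Phi> = (\<lambda>p. (a1 * a2 * a3, a1, a2, a3) + p) \<circ> ?\<Psi>"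
    by (auto simp: cube_to_box_def fun_eq_iff)
  have "linear ?\<Psi>"
    by (rule linearI) (auto simp: algebra_simps)
  then have "?\<Phi> ` (convex hull cube_graph P A B C) = convex hull (?\<Phi> ` cube_graph P A B C)"
    unfolding split image_comp[symmetric]
    by (simp only: convex_hull_linear_image convex_hull_translation)
  also have "?\<Phi> ` cube_graph P A B C =
    {(f, x1, x2, x3). f = x1 * x2 * x3 \<and> (x1, x2, x3) \<in> {a1..b1} \<times> {a2..b2} \<times> {a3..b3}}" (is "_ = ?G")
  proof
    show "?\<Phi> ` cube_graph P A B C \<subseteq> ?G"
      using interpolation_in_interval[OF _ lt(1)] interpolation_in_interval[OF _ lt(2)]
        interpolation_in_interval[OF _ lt(3)]
      by (auto simp: cube_graph_def cube_to_box_def A B C P algebra_simps simp del: atLeastAtMost_iff)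
    show "?G \<subseteq> ?\<Phi> ` cube_graph P A B C"
    proof clarify
      fix f x1 x2 x3 assume x: "x1 \<in> {a1..b1}" "x2 \<in> {a2..b2}" "x3 \<in> {a3..b3}"
      define t1 where "t1 = (x1 - a1) / (b1 - a1)"
      define t2 where "t2 = (x2 - a2) / (b2 - a2)"
      define t3 where "t3 = (x3 - a3) / (b3 - a3)"
      have t: "t1 \<in> {0..1}" "t2 \<in> {0..1}" "t3 \<in> {0..1}"
        using x lt by (auto simp: t1_def t2_def t3_def divide_simps)
      have xt: "x1 = a1 + (b1 - a1) * t1" "x2 = a2 + (b2 - a2) * t2" "x3 = a3 + (b3 - a3) * t3"
        using lt by (simp_all add: t1_def t2_def t3_def)
      show "(x1 * x2 * x3, x1, x2, x3) \<in> ?\<Phi> ` cube_graph P A B C"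
      proof (rule image_eqI)
        show "(A * (t2 * t3) + B * (t1 * t3) + C * (t1 * t2) + P * (t1 * t2 * t3), t1, t2, t3) \<in> cube_graph P A B C"
          using t by (simp add: cube_graph_def)
      qed (simp add: cube_to_box_def xt A B C P algebra_simps)
    qed
  qed
  finally show ?thesis by (simp add: hull_relaxation_def)
qed

text \<open>The relaxation is the region between \<open>L\<close> and \<open>U\<close> over the box. The affine part is common to both
  bounds and cancels in the integral; rescaling to the unit cube gives the factor \<open>P\<close>.\<close>
lemma vol_hull_relaxation_nondegenerate:
  assumes nonneg: "0 \<le> a1" "0 \<le> a2" "0 \<le> a3" and lt: "a1 < b1" "a2 < b2" "a3 < b3"
    and P: "P = (b1 - a1) * (b2 - a2) * (b3 - a3)"
    and A: "A = a1 * (b2 - a2) * (b3 - a3)" and B: "B = (b1 - a1) * a2 * (b3 - a3)"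
    and C: "C = (b1 - a1) * (b2 - a2) * a3"
  shows "vol (hull_relaxation ({a1..b1} \<times> {a2..b2} \<times> {a3..b3})) = box_relaxation_volume P A B C"
proof -
  let ?t1 = "\<lambda>x. (x - a1) / (b1 - a1)"
  let ?t2 = "\<lambda>x. (x - a2) / (b2 - a2)"
  let ?t3 = "\<lambda>x. (x - a3) / (b3 - a3)"
  define aff where "aff = (\<lambda>(x, y, z). a1 * a2 * a3 + a2 * a3 * (x - a1) + a1 * a3 * (y - a2) + a1 * a2 * (z - a3))"
  define L where "L = (\<lambda>(x, y, z). aff (x, y, z) + cube_lower P A B C (?t1 x) (?t2 y) (?t3 z))"
  define U where "U = (\<lambda>(x, y, z). aff (x, y, z) + cube_upper P A B C (?t1 x) (?t2 y) (?t3 z))"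
  have coeff: "0 \<le> A" "0 \<le> B" "0 \<le> C" "0 \<le> P" using nonneg lt by (simp_all add: A B C P)
  have unit: "(x - a) / (b - a) \<in> {0..1} \<longleftrightarrow> x \<in> {a..b}" if "a < b" for a b x :: real
    using that by (auto simp: divide_simps)
  have cont: "continuous_on UNIV L" "continuous_on UNIV U"
    unfolding L_def U_def aff_def case_prod_unfold
    using lt by (intro continuous_intros continuous_cube_bounds; simp)+
  have "hull_relaxation ({a1..b1} \<times> {a2..b2} \<times> {a3..b3}) =
      {(f, p). p \<in> cbox (a1, a2, a3) (b1, b2, b3) \<and> L p \<le> f \<and> f \<le> U p}" (is "_ = ?S")
    unfolding hull_relaxation_eq_affine_image[OF lt P A B C] convex_hull_cube_graph[OF coeff]
  proof (intro equalityI subsetI)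
    fix q assume "q \<in> cube_to_box a1 b1 a2 b2 a3 b3 ` cube_body P A B C"
    then obtain f x y z where fxyz: "(f, x, y, z) \<in> cube_body P A B C"
      and q: "q = (a1 * a2 * a3 + (b1 - a1) * a2 * a3 * x + a1 * (b2 - a2) * a3 * y + a1 * a2 * (b3 - a3) * z + f,
        a1 + (b1 - a1) * x, a2 + (b2 - a2) * y, a3 + (b3 - a3) * z)"
      by (auto simp: cube_to_box_def)
    have t: "?t1 (a1 + (b1 - a1) * x) = x" "?t2 (a2 + (b2 - a2) * y) = y" "?t3 (a3 + (b3 - a3) * z) = z"
      using lt by simp_all
    have "a1 + (b1 - a1) * x \<in> {a1..b1}" "a2 + (b2 - a2) * y \<in> {a2..b2}" "a3 + (b3 - a3) * z \<in> {a3..b3}"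
      using fxyz lt unfolding cube_body_def
      by (auto intro!: interpolation_in_interval simp del: atLeastAtMost_iff)
    moreover have "a1 * a2 * a3 + (b1 - a1) * a2 * a3 * x + a1 * (b2 - a2) * a3 * y + a1 * a2 * (b3 - a3) * z
        = aff (a1 + (b1 - a1) * x, a2 + (b2 - a2) * y, a3 + (b3 - a3) * z)"
      by (simp add: aff_def algebra_simps)
    ultimately show "q \<in> ?S"
      using fxyz lt by (simp add: q L_def U_def cube_body_def)
  next
    fix q assume "q \<in> ?S"
    then obtain f x1 x2 x3 where q: "q = (f, x1, x2, x3)" and x: "x1 \<in> {a1..b1}" "x2 \<in> {a2..b2}" "x3 \<in> {a3..b3}"
      and f: "L (x1, x2, x3) \<le> f" "f \<le> U (x1, x2, x3)"
      by auto
    show "q \<in> cube_to_box a1 b1 a2 b2 a3 b3 ` cube_body P A B C"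
    proof (rule image_eqI)
      show "(f - aff (x1, x2, x3), ?t1 x1, ?t2 x2, ?t3 x3) \<in> cube_body P A B C"
        using f x lt by (simp add: cube_body_def L_def U_def unit del: atLeastAtMost_iff)
    qed (use lt in \<open>simp add: q aff_def cube_to_box_def\<close>)
  qed
  then have "vol (hull_relaxation ({a1..b1} \<times> {a2..b2} \<times> {a3..b3})) =
      integral (cbox (a1, a2, a3) (b1, b2, b3)) (\<lambda>p. U p - L p)"
  proof (simp only: vol_def, intro measure_between_graphs cont)
    fix p assume "p \<in> cbox (a1, a2, a3) (b1, b2, b3)"
    then obtain x y z where p: "p = (x, y, z)" "x \<in> {a1..b1}" "y \<in> {a2..b2}" "z \<in> {a3..b3}"
      by (cases p) auto
    then have "?t1 x \<in> {0..1}" "?t2 y \<in> {0..1}" "?t3 z \<in> {0..1}"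
      using lt by (simp_all add: unit del: atLeastAtMost_iff)
    \<comment> \<open>The graph lies between the two bounds, so the bounds are ordered.\<close>
    then have "(A * (?t2 y * ?t3 z) + B * (?t1 x * ?t3 z) + C * (?t1 x * ?t2 y) + P * (?t1 x * ?t2 y * ?t3 z),
        ?t1 x, ?t2 y, ?t3 z) \<in> cube_graph P A B C"
      by (simp only: cube_graph_def mem_Collect_eq prod.case simp_thms)
    with cube_graph_subset_body[OF coeff] have "(A * (?t2 y * ?t3 z) + B * (?t1 x * ?t3 z) + C * (?t1 x * ?t2 y) + P * (?t1 x * ?t2 y * ?t3 z),
        ?t1 x, ?t2 y, ?t3 z) \<in> cube_body P A B C" by blast
    then have "cube_lower P A B C (?t1 x) (?t2 y) (?t3 z) \<le> cube_upper P A B C (?t1 x) (?t2 y) (?t3 z)"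
      unfolding cube_body_def by (simp del: atLeastAtMost_iff)
    then show "L p \<le> U p" by (simp add: p L_def U_def)
  qed
  also have "(\<lambda>p. U p - L p) = (\<lambda>(x, y, z).
      (\<lambda>(x, y, z). cube_upper P A B C x y z - cube_lower P A B C x y z) (?t1 x, ?t2 y, ?t3 z))"
    by (auto simp: U_def L_def)
  also have "integral (cbox (a1, a2, a3) (b1, b2, b3)) \<dots> = P * ((5 * P + 4 * (A + B + C) - 2 * min A (min B C)) / 24)"
    unfolding P
  proof (subst integral_unit_cube_rescale[OF _ lt])
    show "continuous_on UNIV (\<lambda>(x, y, z). cube_upper Q A B C x y z - cube_lower Q A B C x y z)" for Q
      unfolding case_prod_unfold by (intro continuous_intros continuous_cube_bounds)
  qed (simp only: integral_unique[OF cube_integral_gap])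
  finally show ?thesis by (simp add: box_relaxation_volume_def)
qed

lemma vol_eq_0_in_hyperplane:
  assumes "S \<subseteq> {p. p \<bullet> k = c}" "k \<in> Basis"
  shows "vol S = 0"
proof -
  have "negligible S"
    using negligible_subset[OF negligible_standard_hyperplane[OF assms(2), of c] assms(1)] .
  then show ?thesis by (simp add: vol_def negligible_imp_measure0)
qed

lemma hull_relaxation_coords_subset:
  "hull_relaxation (X \<times> Y \<times> Z) \<subseteq> UNIV \<times> (convex hull X) \<times> (convex hull Y) \<times> (convex hull Z)"
  unfolding hull_relaxation_def
  by (rule hull_minimal) (auto intro!: convex_Times hull_inc)

text \<open>If a side has length zero, then the relaxation lies in a hyperplane and the formula has the
  factor \<open>P = 0\<close>; otherwise the relaxation is the body over the unit cube up to scaling and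
  shearing.\<close>
theorem vol_hull_relaxation:
  assumes nonneg: "0 \<le> a1" "0 \<le> a2" "0 \<le> a3" and le: "a1 \<le> b1" "a2 \<le> b2" "a3 \<le> b3"
  shows "vol (hull_relaxation ({a1..b1} \<times> {a2..b2} \<times> {a3..b3})) =
    box_relaxation_volume ((b1 - a1) * (b2 - a2) * (b3 - a3))
      (a1 * (b2 - a2) * (b3 - a3)) ((b1 - a1) * a2 * (b3 - a3)) ((b1 - a1) * (b2 - a2) * a3)"
proof -
  consider "a1 = b1" | "a2 = b2" | "a3 = b3" | "a1 < b1" "a2 < b2" "a3 < b3" using le by linarith
  then show ?thesis
  proof cases
    case 1
    then have "hull_relaxation ({a1..b1} \<times> {a2..b2} \<times> {a3..b3}) \<subseteq> {p. p \<bullet> (0, 1, 0, 0) = a1}"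
      using hull_relaxation_coords_subset[of "{a1..b1}" "{a2..b2}" "{a3..b3}"] by auto
    from vol_eq_0_in_hyperplane[OF this] 1 show ?thesis
      by (simp add: box_relaxation_volume_def Basis_prod_def zero_prod_def)
  next
    case 2
    then have "hull_relaxation ({a1..b1} \<times> {a2..b2} \<times> {a3..b3}) \<subseteq> {p. p \<bullet> (0, 0, 1, 0) = a2}"
      using hull_relaxation_coords_subset[of "{a1..b1}" "{a2..b2}" "{a3..b3}"] by auto
    from vol_eq_0_in_hyperplane[OF this] 2 show ?thesis
      by (simp add: box_relaxation_volume_def Basis_prod_def zero_prod_def)
  next
    case 3
    then have "hull_relaxation ({a1..b1} \<times> {a2..b2} \<times> {a3..b3}) \<subseteq> {p. p \<bullet> (0, 0, 0, 1) = a3}"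
      using hull_relaxation_coords_subset[of "{a1..b1}" "{a2..b2}" "{a3..b3}"] by auto
    from vol_eq_0_in_hyperplane[OF this] 3 show ?thesis
      by (simp add: box_relaxation_volume_def Basis_prod_def zero_prod_def)
  next
    case 4
    then show ?thesis using vol_hull_relaxation_nondegenerate[OF nonneg] by simp
  qed
qed

text \<open>x\<close>
section \<open>Total volume after branching\<close>

text \<open>Here \<open>A\<close> is the coefficient that comes from the branching variable. The left child keeps the lower
  end point of that variable, so its \<open>A\<close> is unchanged while everything else shrinks by the factor \<open>s\<close>.
  In the right child the lower end point has moved up, which adds \<open>s P\<close> to \<open>A\<close>, and everything else
  shrinks by the factor \<open>1 - s\<close>.\<close>
definition branching_profile :: "real \<Rightarrow> real \<Rightarrow> real \<Rightarrow> real \<Rightarrow> real \<Rightarrow> real" where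
  "branching_profile P A B C s =
     s * (5 * (s * P) + 4 * (A + s * B + s * C) - 2 * min A (min (s * B) (s * C))) +
     (1 - s) * (5 * ((1 - s) * P) + 4 * ((A + s * P) + (1 - s) * B + (1 - s) * C) -
       2 * min (A + s * P) (min ((1 - s) * B) ((1 - s) * C)))"

lemma box_relaxation_volume_perm:
  "box_relaxation_volume P B A C = box_relaxation_volume P A B C"
  "box_relaxation_volume P C A B = box_relaxation_volume P A B C"
  by (simp_all add: box_relaxation_volume_def min.left_commute min.commute add_ac)

lemma box_relaxation_volume_children:
  "box_relaxation_volume (s * P) A (s * B) (s * C) +
   box_relaxation_volume ((1 - s) * P) (A + s * P) ((1 - s) * B) ((1 - s) * C) =
   P / 24 * branching_profile P A B C s"
  by (simp add: box_relaxation_volume_def branching_profile_def field_simps)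

text \<open>The three branching variables differ only in the slot that holds the unscaled coefficient; the
  symmetry of \<open>box_relaxation_volume\<close> moves it to the front.\<close>
lemma branching_volume_x1:
  assumes "0 \<le> a1" "0 \<le> a2" "0 \<le> a3" and lt: "a1 < b1" "a2 < b2" "a3 < b3" and c: "c \<in> {a1..b1}"
  shows "branching_volume (\<lambda>(x1, x2, x3). x1) ({a1..b1} \<times> {a2..b2} \<times> {a3..b3}) c =
    (b1 - a1) * (b2 - a2) * (b3 - a3) / 24 *
    branching_profile ((b1 - a1) * (b2 - a2) * (b3 - a3)) (a1 * (b2 - a2) * (b3 - a3))
      ((b1 - a1) * a2 * (b3 - a3)) ((b1 - a1) * (b2 - a2) * a3) ((c - a1) / (b1 - a1))"
proof -
  define s where "s = (c - a1) / (b1 - a1)"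
  have left: "c - a1 = s * (b1 - a1)"
    using lt unfolding s_def by (intro nonzero_divide_eq_eq[THEN iffD1]) auto
  then have right: "b1 - c = (1 - s) * (b1 - a1)"
    by (simp only: left_diff_distrib) simp
  have shift: "c * (b2 - a2) * (b3 - a3) = a1 * (b2 - a2) * (b3 - a3) + s * ((b1 - a1) * (b2 - a2) * (b3 - a3))"
    using left by algebra
  have "vol (hull_relaxation ({a1..c} \<times> {a2..b2} \<times> {a3..b3})) =
      box_relaxation_volume (s * ((b1 - a1) * (b2 - a2) * (b3 - a3)))
        (a1 * (b2 - a2) * (b3 - a3))
        (s * ((b1 - a1) * a2 * (b3 - a3))) (s * ((b1 - a1) * (b2 - a2) * a3))"
    using vol_hull_relaxation[of a1 a2 a3 c b2 b3] assms by (simp add: left mult_ac)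
  moreover have "vol (hull_relaxation ({c..b1} \<times> {a2..b2} \<times> {a3..b3})) =
      box_relaxation_volume ((1 - s) * ((b1 - a1) * (b2 - a2) * (b3 - a3)))
        (a1 * (b2 - a2) * (b3 - a3) + s * ((b1 - a1) * (b2 - a2) * (b3 - a3)))
        ((1 - s) * ((b1 - a1) * a2 * (b3 - a3))) ((1 - s) * ((b1 - a1) * (b2 - a2) * a3))"
    using vol_hull_relaxation[of c a2 a3 b1 b2 b3] assms unfolding shift right
    by (simp add: mult_ac)
  moreover have "({a1..b1} \<times> {a2..b2} \<times> {a3..b3}) \<inter> {x. (\<lambda>(x1, x2, x3). x1) x \<le> c} = {a1..c} \<times> {a2..b2} \<times> {a3..b3}"
    "({a1..b1} \<times> {a2..b2} \<times> {a3..b3}) \<inter> {x. (\<lambda>(x1, x2, x3). x1) x \<ge> c} = {c..b1} \<times> {a2..b2} \<times> {a3..b3}"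
    using c by auto
  ultimately show ?thesis
    by (simp only: branching_volume_def s_def[symmetric] box_relaxation_volume_children[symmetric])
qed

lemma branching_volume_x2:
  assumes "0 \<le> a1" "0 \<le> a2" "0 \<le> a3" and lt: "a1 < b1" "a2 < b2" "a3 < b3" and c: "c \<in> {a2..b2}"
  shows "branching_volume (\<lambda>(x1, x2, x3). x2) ({a1..b1} \<times> {a2..b2} \<times> {a3..b3}) c =
    (b1 - a1) * (b2 - a2) * (b3 - a3) / 24 *
    branching_profile ((b1 - a1) * (b2 - a2) * (b3 - a3)) ((b1 - a1) * a2 * (b3 - a3))
      (a1 * (b2 - a2) * (b3 - a3)) ((b1 - a1) * (b2 - a2) * a3) ((c - a2) / (b2 - a2))"
proof -
  define s where "s = (c - a2) / (b2 - a2)"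
  have left: "c - a2 = s * (b2 - a2)"
    using lt unfolding s_def by (intro nonzero_divide_eq_eq[THEN iffD1]) auto
  then have right: "b2 - c = (1 - s) * (b2 - a2)"
    by (simp only: left_diff_distrib) simp
  have shift: "(b1 - a1) * c * (b3 - a3) = (b1 - a1) * a2 * (b3 - a3) + s * ((b1 - a1) * (b2 - a2) * (b3 - a3))"
    using left by algebra
  have "vol (hull_relaxation ({a1..b1} \<times> {a2..c} \<times> {a3..b3})) =
      box_relaxation_volume (s * ((b1 - a1) * (b2 - a2) * (b3 - a3)))
        (s * (a1 * (b2 - a2) * (b3 - a3)))
        ((b1 - a1) * a2 * (b3 - a3)) (s * ((b1 - a1) * (b2 - a2) * a3))"
    using vol_hull_relaxation[of a1 a2 a3 b1 c b3] assms by (simp add: left mult_ac)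
  moreover have "vol (hull_relaxation ({a1..b1} \<times> {c..b2} \<times> {a3..b3})) =
      box_relaxation_volume ((1 - s) * ((b1 - a1) * (b2 - a2) * (b3 - a3)))
        ((1 - s) * (a1 * (b2 - a2) * (b3 - a3)))
        ((b1 - a1) * a2 * (b3 - a3) + s * ((b1 - a1) * (b2 - a2) * (b3 - a3))) ((1 - s) * ((b1 - a1) * (b2 - a2) * a3))"
    using vol_hull_relaxation[of a1 c a3 b1 b2 b3] assms unfolding shift right
    by (simp add: mult_ac)
  moreover have "({a1..b1} \<times> {a2..b2} \<times> {a3..b3}) \<inter> {x. (\<lambda>(x1, x2, x3). x2) x \<le> c} = {a1..b1} \<times> {a2..c} \<times> {a3..b3}"
    "({a1..b1} \<times> {a2..b2} \<times> {a3..b3}) \<inter> {x. (\<lambda>(x1, x2, x3). x2) x \<ge> c} = {a1..b1} \<times> {c..b2} \<times> {a3..b3}"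
    using c by auto
  ultimately show ?thesis
    by (simp only: branching_volume_def s_def[symmetric] box_relaxation_volume_children[symmetric])
      (intro arg_cong2[where f = "(+)"] box_relaxation_volume_perm(1))
qed

lemma branching_volume_x3:
  assumes "0 \<le> a1" "0 \<le> a2" "0 \<le> a3" and lt: "a1 < b1" "a2 < b2" "a3 < b3" and c: "c \<in> {a3..b3}"
  shows "branching_volume (\<lambda>(x1, x2, x3). x3) ({a1..b1} \<times> {a2..b2} \<times> {a3..b3}) c =
    (b1 - a1) * (b2 - a2) * (b3 - a3) / 24 *
    branching_profile ((b1 - a1) * (b2 - a2) * (b3 - a3)) ((b1 - a1) * (b2 - a2) * a3)
      (a1 * (b2 - a2) * (b3 - a3)) ((b1 - a1) * a2 * (b3 - a3)) ((c - a3) / (b3 - a3))"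
proof -
  define s where "s = (c - a3) / (b3 - a3)"
  have left: "c - a3 = s * (b3 - a3)"
    using lt unfolding s_def by (intro nonzero_divide_eq_eq[THEN iffD1]) auto
  then have right: "b3 - c = (1 - s) * (b3 - a3)"
    by (simp only: left_diff_distrib) simp
  have shift: "(b1 - a1) * (b2 - a2) * c = (b1 - a1) * (b2 - a2) * a3 + s * ((b1 - a1) * (b2 - a2) * (b3 - a3))"
    using left by algebra
  have "vol (hull_relaxation ({a1..b1} \<times> {a2..b2} \<times> {a3..c})) =
      box_relaxation_volume (s * ((b1 - a1) * (b2 - a2) * (b3 - a3)))
        (s * (a1 * (b2 - a2) * (b3 - a3)))
        (s * ((b1 - a1) * a2 * (b3 - a3))) ((b1 - a1) * (b2 - a2) * a3)"
    using vol_hull_relaxation[of a1 a2 a3 b1 b2 c] assms by (simp add: left mult_ac)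
  moreover have "vol (hull_relaxation ({a1..b1} \<times> {a2..b2} \<times> {c..b3})) =
      box_relaxation_volume ((1 - s) * ((b1 - a1) * (b2 - a2) * (b3 - a3)))
        ((1 - s) * (a1 * (b2 - a2) * (b3 - a3)))
        ((1 - s) * ((b1 - a1) * a2 * (b3 - a3))) ((b1 - a1) * (b2 - a2) * a3 + s * ((b1 - a1) * (b2 - a2) * (b3 - a3)))"
    using vol_hull_relaxation[of a1 a2 c b1 b2 b3] assms unfolding shift right
    by (simp add: mult_ac)
  moreover have "({a1..b1} \<times> {a2..b2} \<times> {a3..b3}) \<inter> {x. (\<lambda>(x1, x2, x3). x3) x \<le> c} = {a1..b1} \<times> {a2..b2} \<times> {a3..c}"
    "({a1..b1} \<times> {a2..b2} \<times> {a3..b3}) \<inter> {x. (\<lambda>(x1, x2, x3). x3) x \<ge> c} = {a1..b1} \<times> {a2..b2} \<times> {c..b3}"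
    using c by auto
  ultimately show ?thesis
    by (simp only: branching_volume_def s_def[symmetric] box_relaxation_volume_children[symmetric])
      (intro arg_cong2[where f = "(+)"] box_relaxation_volume_perm(2)[symmetric])
qed

text \<open>If \<open>B\<close> is the smallest coefficient before branching, then it stays so in both children, because
  \<open>B\<close> shrinks while \<open>A\<close> does not. This removes the minima, and the rest is a polynomial in \<open>s (1 - s)\<close>.\<close>
lemma branching_profile_dominated:
  assumes "0 \<le> B" "0 \<le> P" "B \<le> A" "B \<le> C" and s: "s \<in> {0..1}"
  shows "branching_profile P A B C s = 5 * P + 2 * B + 4 * C + 4 * A - s * (1 - s) * (6 * P + 4 * B + 8 * C)"
proof -
  have "s * B \<le> 1 * B" "(1 - s) * B \<le> 1 * B" "s * B \<le> s * C" "(1 - s) * B \<le> (1 - s) * C" "0 \<le> s * P"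
    using assms by (intro mult_right_mono mult_left_mono mult_nonneg_nonneg; simp)+
  then have "min A (min (s * B) (s * C)) = s * B" "min (A + s * P) (min ((1 - s) * B) ((1 - s) * C)) = (1 - s) * B"
    using assms(3) by linarith+
  then show ?thesis by (simp add: branching_profile_def algebra_simps power2_eq_square)
qed

lemma branching_profile_dominated_min:
  assumes "0 \<le> B" "0 \<le> P" "B \<le> A" "B \<le> C" and s: "s \<in> {0..1}"
  shows "branching_profile P A B C (1 / 2) \<le> branching_profile P A B C s"
proof -
  have "0 \<le> (s - 1 / 2)\<^sup>2" by simp
  then have "s * (1 - s) \<le> 1 / 4" by (simp add: power2_eq_square algebra_simps)
  then have "s * (1 - s) * (6 * P + 4 * B + 8 * C) \<le> 1 / 4 * (6 * P + 4 * B + 8 * C)"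
    using assms by (intro mult_right_mono) auto
  then show ?thesis using assms by (simp add: branching_profile_dominated)
qed

text \<open>The first inequality amounts to
  \<open>3 A - 2 B \<le> min {A, B / 2} + min {A + P / 2, B / 2}\<close>, which holds for each choice in the minima;
  the second one to \<open>B \<le> C\<close>.\<close>
lemma branching_profile_half_le:
  assumes "0 \<le> A" "0 \<le> P" "A \<le> B" "B \<le> C"
  shows "branching_profile P A B C (1 / 2) \<le> branching_profile P B A C (1 / 2)"
    and "branching_profile P B A C (1 / 2) \<le> branching_profile P C A B (1 / 2)"
proof -
  have "min A (min (B / 2) (C / 2)) + min (A + P / 2) (min (B / 2) (C / 2)) \<ge> 3 * A - 2 * B"
    using assms by linarith
  then show "branching_profile P A B C (1 / 2) \<le> branching_profile P B A C (1 / 2)"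
    using assms by (simp add: branching_profile_dominated) (simp add: branching_profile_def field_simps)
  show "branching_profile P B A C (1 / 2) \<le> branching_profile P C A B (1 / 2)"
    using assms by (simp add: branching_profile_dominated)
qed

lemma continuous_branching_profile:
  "continuous_on S f \<Longrightarrow> continuous_on S (\<lambda>c. branching_profile P A B C (f c))"
  unfolding branching_profile_def by (intro continuous_intros)

section \<open>Comparison of the branching variables\<close>

theorem theorem7:
  fixes a1 b1 a2 b2 a3 b3 :: real
  assumes "Omega a1 b1 a2 b2 a3 b3"
  shows
    "let B0 = {a1..b1} \<times> {a2..b2} \<times> {a3..b3};
         T1 = branching_volume (\<lambda>(x1, x2, x3). x1) B0;
         T2 = branching_volume (\<lambda>(x1, x2, x3). x2) B0;
         T3 = branching_volume (\<lambda>(x1, x2, x3). x3) B0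
     in \<exists>c1 c2 c3.
          is_arg_min T1 (\<lambda>c. c \<in> {a1..b1}) c1 \<and>
          is_arg_min T2 (\<lambda>c. c \<in> {a2..b2}) c2 \<and>
          is_arg_min T3 (\<lambda>c. c \<in> {a3..b3}) c3 \<and>
          T1 c1 \<le> T2 c2 \<and> T2 c2 \<le> T3 c3 \<and>
          T1 ((a1 + b1) / 2) \<le> T2 c2 \<and>
          T1 ((a1 + b1) / 2) \<le> T3 c3"
proof -
  define P where "P = (b1 - a1) * (b2 - a2) * (b3 - a3)"
  define A where "A = a1 * (b2 - a2) * (b3 - a3)"
  define B where "B = (b1 - a1) * a2 * (b3 - a3)"
  define C where "C = (b1 - a1) * (b2 - a2) * a3"
  define B0 where "B0 = {a1..b1} \<times> {a2..b2} \<times> {a3..b3}"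
  define T1 where "T1 = branching_volume (\<lambda>(x1, x2, x3). x1) B0"
  define T2 where "T2 = branching_volume (\<lambda>(x1, x2, x3). x2) B0"
  define T3 where "T3 = branching_volume (\<lambda>(x1, x2, x3). x3) B0"
  have nonneg: "0 \<le> a1" "0 \<le> a2" "0 \<le> a3" and lt: "a1 < b1" "a2 < b2" "a3 < b3"
    using assms by (auto simp: Omega_def)
  have "0 \<le> A" "0 \<le> P" using nonneg lt by (simp_all add: A_def P_def)
  moreover have "A \<le> B" "B \<le> C"
    using assms by (simp_all add: Omega_def A_def B_def C_def algebra_simps)
  ultimately have coeff: "0 \<le> A" "A \<le> B" "B \<le> C" "0 \<le> P" by simp_all
  have T1: "T1 c = P / 24 * branching_profile P A B C ((c - a1) / (b1 - a1))" if "c \<in> {a1..b1}" for c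
    unfolding T1_def B0_def P_def A_def B_def C_def by (rule branching_volume_x1[OF nonneg lt that])
  have T2: "T2 c = P / 24 * branching_profile P B A C ((c - a2) / (b2 - a2))" if "c \<in> {a2..b2}" for c
    unfolding T2_def B0_def P_def A_def B_def C_def by (rule branching_volume_x2[OF nonneg lt that])
  have T3: "T3 c = P / 24 * branching_profile P C A B ((c - a3) / (b3 - a3))" if "c \<in> {a3..b3}" for c
    unfolding T3_def B0_def P_def A_def B_def C_def by (rule branching_volume_x3[OF nonneg lt that])
  have mid: "(a + b) / 2 \<in> {a..b}" "((a + b) / 2 - a) / (b - a) = 1 / 2" if "a < b" for a b :: real
    using that by (auto simp: field_simps)
  have unit: "(c - a) / (b - a) \<in> {0..1}" if "a < b" "c \<in> {a..b}" for a b c :: real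
    using that by (auto simp: divide_simps)
  let ?c1 = "(a1 + b1) / 2" and ?c2 = "(a2 + b2) / 2" and ?c3 = "(a3 + b3) / 2"
  \<comment> \<open>The profile for the first variable keeps its minima, so its minimiser comes from compactness.\<close>
  have "continuous_on {a1..b1} T1"
  proof (subst continuous_on_cong[OF refl T1])
    show "continuous_on {a1..b1} (\<lambda>c. P / 24 * branching_profile P A B C ((c - a1) / (b1 - a1)))"
      using lt by (intro continuous_intros continuous_branching_profile) auto
  qed
  then obtain c1 where c1: "c1 \<in> {a1..b1}" "\<And>c. c \<in> {a1..b1} \<Longrightarrow> T1 c1 \<le> T1 c"
    using continuous_attains_inf[of "{a1..b1}" T1] lt by auto
  have min2: "T2 ?c2 \<le> T2 c" if "c \<in> {a2..b2}" for c
    using branching_profile_dominated_min[OF coeff(1,4,2), of C] coeff unit[OF lt(2) that] that lt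
    by (simp only: T2 mid) (intro mult_left_mono; simp)
  have min3: "T3 ?c3 \<le> T3 c" if "c \<in> {a3..b3}" for c
    using branching_profile_dominated_min[OF coeff(1,4), of C B] coeff unit[OF lt(3) that] that lt
    by (simp only: T3 mid) (intro mult_left_mono; simp)
  have T12: "T1 ?c1 \<le> T2 ?c2" and T23: "T2 ?c2 \<le> T3 ?c3"
    using branching_profile_half_le[OF coeff(1,4,2,3)] coeff lt
    by (simp_all only: T1 T2 T3 mid) (intro mult_left_mono; simp)+
  have "is_arg_min T1 (\<lambda>c. c \<in> {a1..b1}) c1" "is_arg_min T2 (\<lambda>c. c \<in> {a2..b2}) ?c2"
    "is_arg_min T3 (\<lambda>c. c \<in> {a3..b3}) ?c3"
    using c1 min2 min3 mid(1) lt unfolding is_arg_min_def by (simp_all add: not_less del: atLeastAtMost_iff)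
  moreover have "T1 c1 \<le> T1 ?c1" using c1(2) mid(1)[OF lt(1)] .
  ultimately show ?thesis
    using T12 T23 unfolding Let_def T1_def[unfolded B0_def, symmetric]
      T2_def[unfolded B0_def, symmetric] T3_def[unfolded B0_def, symmetric]
    by (meson order_trans)
qed

end
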